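(* For every finite graph $G$ there is a finite Boolean ring $R$ such that $G$ is isomorphic to an induced subgraph of the zero-divisor graph $\Gamma(R)$.
   Context: Rings are finite commutative rings with unity; graphs are finite simple undirected graphs. For a ring $R$, the zero-divisor graph $\Gamma(R)$ has as vertices the non-zero elements $a\in R$ for which there exists $b\neq 0$ in $R$ with $ab=0$; two distinct vertices $a,b$ are adjacent if and only if $ab=0$. For a finite set $X$, the Boolean ring on $X$ has the subsets of $X$ as elements, symmetric difference as addition and intersection as multiplication. *)

theory Defs
  imports
    "HOL-Algebra.Ring"
    "Graph_Theory.Pair_Digraph"
    "Graph_Theory.Digraph_Isomorphism"
begin

text \<open>
  As in Graph\_Theory, a finite simple undirected graph is a \<^locale>\<open>pair_graph\<close>: each edge
  is represented by its two orientations as ordered pairs.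
\<close>

definition zero_divisor_graph :: "('a, 'm) ring_scheme \<Rightarrow> 'a pair_pre_digraph" where
  "zero_divisor_graph R =
    (let V = {a \<in> carrier R - {\<zero>\<^bsub>R\<^esub>}. \<exists>b \<in> carrier R - {\<zero>\<^bsub>R\<^esub>}. a \<otimes>\<^bsub>R\<^esub> b = \<zero>\<^bsub>R\<^esub>}
     in \<lparr> pverts = V,
          parcs = {(a, b). a \<in> V \<and> b \<in> V \<and> a \<noteq> b \<and> a \<otimes>\<^bsub>R\<^esub> b = \<zero>\<^bsub>R\<^esub>} \<rparr>)"

lemma (in cring) pair_graph_zero_divisor_graph:
  assumes "finite (carrier R)"
  shows "pair_graph (zero_divisor_graph R)"
proof -
  let ?G = "zero_divisor_graph R"
  have V: "finite (pverts ?G)"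
    using assms by (simp add: zero_divisor_graph_def)
  have sub: "parcs ?G \<subseteq> pverts ?G \<times> pverts ?G"
    by (auto simp: zero_divisor_graph_def Let_def)
  have E: "finite (parcs ?G)"
    by (rule finite_subset[OF sub]) (simp add: V)
  have sym: "sym (parcs ?G)"
  proof (rule symI)
    fix a b assume ab: "(a, b) \<in> parcs ?G"
    then have "a \<in> carrier R" "b \<in> carrier R"
      by (simp_all add: zero_divisor_graph_def Let_def)
    with ab show "(b, a) \<in> parcs ?G"
      using m_comm[of a b] by (simp add: zero_divisor_graph_def Let_def eq_commute[of b a])
  qed
  have loop: "\<And>e. e \<in> parcs ?G \<Longrightarrow> fst e \<noteq> snd e"
    by (auto simp: zero_divisor_graph_def Let_def)
  have "arcs_ends (with_proj ?G) = parcs ?G"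
    by (simp add: arcs_ends_def arc_to_ends_def)
  with sym have "symmetric (with_proj ?G)"
    by (simp add: symmetric_def)
  show ?thesis
  proof
    show "symmetric (with_proj ?G)" by fact
  next
    fix e assume e: "e \<in> parcs ?G"
    then show "fst e \<in> pverts ?G" "snd e \<in> pverts ?G"
      using sub by auto
    show "fst e \<noteq> snd e" using e by (rule loop)
  qed (rule V E)+
qed

definition boolean_ring :: "'a set \<Rightarrow> 'a set ring" where
  "boolean_ring X =
    \<lparr> carrier = Pow X, monoid.mult = (\<inter>), one = X, zero = {}, add = sym_diff \<rparr>"

lemma cring_boolean_ring: "cring (boolean_ring X)"
proof (rule cringI)
  show "abelian_group (boolean_ring X)"
  proof (rule abelian_groupI)
    fix A assume "A \<in> carrier (boolean_ring X)"
    then show "\<exists>B\<in>carrier (boolean_ring X). B \<oplus>\<^bsub>boolean_ring X\<^esub> A = \<zero>\<^bsub>boolean_ring X\<^esub>"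
      by (intro bexI[of _ A]) (auto simp: boolean_ring_def)
  qed (auto simp: boolean_ring_def)
  show "comm_monoid (boolean_ring X)"
    by (rule comm_monoidI) (auto simp: boolean_ring_def)
qed (auto simp: boolean_ring_def)

lemma boolean_ring_idem:
  "A \<in> carrier (boolean_ring X) \<Longrightarrow> A \<otimes>\<^bsub>boolean_ring X\<^esub> A = A"
  by (simp add: boolean_ring_def)

lemma finite_carrier_boolean_ring: "finite (carrier (boolean_ring X)) \<longleftrightarrow> finite X"
  by (simp add: boolean_ring_def)

end

theory Submission
  imports Defs
begin

text \<open>
  Map a vertex \<open>v\<close> to the set \<open>S v\<close> of all independent vertex sets that contain \<open>v\<close>. Since \<open>{u, v}\<close>
  is independent exactly if \<open>u\<close> and \<open>v\<close> are not adjacent, distinct \<open>u\<close> and \<open>v\<close> are adjacent if and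
  only if \<open>S u \<inter> S v = {}\<close>. The singleton \<open>{v}\<close> makes \<open>S v\<close> nonempty and different from the other
  \<open>S u\<close>. The empty set is independent and lies in no \<open>S v\<close>, so \<open>{{}}\<close> annihilates every \<open>S v\<close>.
\<close>

definition independent_sets :: "'a pair_pre_digraph \<Rightarrow> 'a set set" where
  "independent_sets G = {P. P \<subseteq> pverts G \<and> P \<times> P \<inter> parcs G = {}}"

definition independent_star :: "'a pair_pre_digraph \<Rightarrow> 'a \<Rightarrow> 'a set set" where
  "independent_star G v = {P \<in> independent_sets G. v \<in> P}"

lemma finite_independent_sets: "finite (pverts G) \<Longrightarrow> finite (independent_sets G)"
  by (rule finite_subset[of _ "Pow (pverts G)"]) (auto simp: independent_sets_def)

lemma empty_in_independent_sets: "{} \<in> independent_sets G"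
  by (simp add: independent_sets_def)

lemma independent_star_subset: "independent_star G v \<subseteq> independent_sets G"
  by (auto simp: independent_star_def)

lemma empty_notin_independent_star: "{} \<notin> independent_star G v"
  by (simp add: independent_star_def)

text \<open>Looplessness makes \<open>{u}\<close> independent: its only possible arc is a loop at
  \<open>u\<close>. The singletons thus tell the stars apart and show that none is empty.\<close>

lemma (in pair_loopfree_digraph) singleton_in_independent_star_iff:
  assumes "u \<in> pverts G"
  shows "{u} \<in> independent_star G v \<longleftrightarrow> u = v"
  using assms by (auto simp: independent_star_def independent_sets_def dest: pair_no_loops)

lemma (in pair_loopfree_digraph) inj_on_independent_star:
  "inj_on (independent_star G) (pverts G)"
  by (rule inj_onI) (metis singleton_in_independent_star_iff)

lemma (in pair_bidirected_digraph) independent_stars_disjoint_iff: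
  assumes "u \<in> pverts G" "v \<in> pverts G" "u \<noteq> v"
  shows "independent_star G u \<inter> independent_star G v = {} \<longleftrightarrow> (u, v) \<in> parcs G"
proof
  assume disj: "independent_star G u \<inter> independent_star G v = {}"
  \<comment> \<open>If \<open>{u, v}\<close> is not independent, it carries an arc in one of the two
    orientations or a loop. Symmetry reduces the orientations to \<open>(u, v)\<close>, and loops
    are excluded.\<close>
  have "(v, u) \<in> parcs G \<Longrightarrow> (u, v) \<in> parcs G"
    using pair_sym_arcs by (auto simp: symmetric_def dest: symD)
  moreover have "{u, v} \<notin> independent_sets G"
    using disj by (auto simp: independent_star_def)
  ultimately show "(u, v) \<in> parcs G"
    using assms by (auto simp: independent_sets_def dest: pair_no_loops)
qed (auto simp: independent_star_def independent_sets_def)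

text \<open>Arcs are pairs of vertices, so injectivity on vertices passes to
  \<open>map_prod f f\<close> on arcs.\<close>

lemma (in pair_wf_digraph) digraph_iso_map_prod:
  assumes "inj_on f (pverts G)"
  shows "digraph_iso (with_proj G)
    (with_proj \<lparr>pverts = f ` pverts G, parcs = map_prod f f ` parcs G\<rparr>)"
proof -
  let ?h = "\<lparr>iso_verts = f, iso_arcs = map_prod f f, iso_head = snd, iso_tail = fst\<rparr>"
  have "parcs G \<subseteq> pverts G \<times> pverts G"
    by (auto dest: wellformed')
  then have "inj_on (map_prod f f) (parcs G)"
    using map_prod_inj_on[OF assms assms] inj_on_subset by blast
  then have "digraph_isomorphism ?h"
    using assms wf_digraph_wp_iff pair_wf_digraph_axioms by (auto simp: digraph_isomorphism_def)
  moreover have "with_proj \<lparr>pverts = f ` pverts G, parcs = map_prod f f ` parcs G\<rparr>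
      = app_iso ?h (with_proj G)"
    by (simp add: with_proj_def app_iso_def)
  ultimately show ?thesis
    unfolding digraph_iso_def by blast
qed

lemma induced_subgraph_with_projI:
  assumes "pverts H \<subseteq> pverts G"
    and "parcs H = {(a, b) \<in> parcs G. a \<in> pverts H \<and> b \<in> pverts H}"
    and "pair_wf_digraph G"
  shows "induced_subgraph (with_proj H) (with_proj G)"
proof -
  have "pair_wf_digraph H"
    using assms(2) by unfold_locales auto
  then show ?thesis
    using assms by (auto simp: induced_subgraph_def subgraph_def wf_digraph_wp_iff)
qed

lemma pair_wf_digraph_zero_divisor_graph: "pair_wf_digraph (zero_divisor_graph R)"
  by unfold_locales (auto simp: zero_divisor_graph_def Let_def)

text \<open>The complement \<open>X - A\<close> annihilates \<open>A\<close> and is nonzero exactly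
  if \<open>A\<close> is proper; \<open>X\<close> is the unit and hence no zero divisor.\<close>

lemma pverts_zero_divisor_graph_boolean_ring:
  "pverts (zero_divisor_graph (boolean_ring X)) = {A. A \<noteq> {} \<and> A \<subset> X}"
proof -
  have "\<exists>B. B \<subseteq> X \<and> B \<noteq> {} \<and> A \<inter> B = {}" if "A \<subset> X" for A
    using that by (intro exI[of _ "X - A"]) auto
  then show ?thesis
    by (auto simp: zero_divisor_graph_def boolean_ring_def)
qed

text \<open>Disjoint nonempty sets are automatically distinct, so the condition
  \<open>a \<noteq> b\<close> disappears.\<close>

lemma parcs_zero_divisor_graph_boolean_ring:
  "parcs (zero_divisor_graph (boolean_ring X)) =
    {(A, B). A \<noteq> {} \<and> A \<subset> X \<and> B \<noteq> {} \<and> B \<subset> X \<and> A \<inter> B = {}}"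
proof -
  have "parcs (zero_divisor_graph R) =
      {(a, b) \<in> pverts (zero_divisor_graph R) \<times> pverts (zero_divisor_graph R).
        a \<noteq> b \<and> a \<otimes>\<^bsub>R\<^esub> b = \<zero>\<^bsub>R\<^esub>}" for R :: "'a set ring"
    by (auto simp: zero_divisor_graph_def Let_def)
  then show ?thesis
    by (auto simp: pverts_zero_divisor_graph_boolean_ring) (auto simp: boolean_ring_def)
qed

theorem theorem2p3:
  fixes G :: "'a pair_pre_digraph"
  assumes "pair_graph G"
  shows "\<exists>(X :: nat set) (H :: nat set pair_pre_digraph).
    finite X \<and>
    induced_subgraph (with_proj H) (with_proj (zero_divisor_graph (boolean_ring X))) \<and>
    digraph_iso (with_proj G) (with_proj H)"
proof -
  interpret pair_graph G by fact
  interpret pair_bidirected_digraph G by unfold_locales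
  \<comment> \<open>The ground set of the ring must consist of naturals, so the independent sets are
    numbered by \<open>e\<close>. As \<open>e\<close> is injective on them, images under
    \<open>e\<close> preserve and reflect equality and disjointness of stars.\<close>
  obtain e :: "'a set \<Rightarrow> nat" where e: "inj_on e (independent_sets G)"
    using finite_imp_inj_to_nat_seg[OF finite_independent_sets[OF pair_finite_verts]] by blast
  define X where "X = e ` independent_sets G"
  define f where "f v = e ` independent_star G v" for v
  define H where "H = \<lparr>pverts = f ` pverts G, parcs = map_prod f f ` parcs G\<rparr>"
  have f_eq: "f u = f v \<longleftrightarrow> independent_star G u = independent_star G v" for u v
    unfolding f_def by (intro inj_on_image_eq_iff[OF e] independent_star_subset)
  have inj: "inj_on f (pverts G)"
    using inj_on_independent_star by (simp add: inj_on_def f_eq)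
  have disj: "f u \<inter> f v = {} \<longleftrightarrow> independent_star G u \<inter> independent_star G v = {}" for u v
    unfolding f_def
    by (simp flip: inj_on_image_Int[OF e independent_star_subset independent_star_subset])
  have vertex: "f v \<noteq> {} \<and> f v \<subset> X" if "v \<in> pverts G" for v
  proof -
    have "independent_star G v \<noteq> {}"
      using singleton_in_independent_star_iff[OF that] by blast
    moreover have "independent_star G v \<subset> independent_sets G"
      using independent_star_subset[of G v] empty_notin_independent_star[of G v]
        empty_in_independent_sets[of G] by auto
    ultimately show ?thesis
      unfolding f_def X_def using image_strict_mono[OF e] by auto
  qed
  have adjacent: "(u, v) \<in> parcs G \<longleftrightarrow> f u \<inter> f v = {}" if "u \<in> pverts G" "v \<in> pverts G" for u v
  \<comment> \<open>On the diagonal both sides are false: there are no loops, and \<open>f u\<close>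
    is nonempty.\<close>
  proof (cases "u = v")
    case True
    then show ?thesis
      using vertex[OF that(1)] by (auto dest: pair_no_loops)
  next
    case False
    then show ?thesis
      using independent_stars_disjoint_iff that by (simp add: disj)
  qed
  \<comment> \<open>\<open>H\<close> arises by transporting the arcs of \<open>G\<close>; here its
    arcs turn out to be all disjoint pairs of its vertices, which is what makes it induced.\<close>
  have "parcs H = {(a, b) \<in> f ` pverts G \<times> f ` pverts G. a \<inter> b = {}}"
  proof (intro Set.set_eqI iffI)
    fix p assume "p \<in> parcs H"
    then obtain u v where "(u, v) \<in> parcs G" "p = (f u, f v)"
      by (auto simp: H_def)
    then show "p \<in> {(a, b) \<in> f ` pverts G \<times> f ` pverts G. a \<inter> b = {}}"
      using adjacent wellformed' by blast
  next
    fix p assume "p \<in> {(a, b) \<in> f ` pverts G \<times> f ` pverts G. a \<inter> b = {}}"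
    then obtain u v where "u \<in> pverts G" "v \<in> pverts G" "f u \<inter> f v = {}" "p = (f u, f v)"
      by auto
    then have "(u, v) \<in> parcs G" "p = map_prod f f (u, v)"
      using adjacent by auto
    then show "p \<in> parcs H"
      unfolding H_def by (metis image_eqI pair_pre_digraph.select_convs(2))
  qed
  then have "induced_subgraph (with_proj H) (with_proj (zero_divisor_graph (boolean_ring X)))"
    using vertex
    by (intro induced_subgraph_with_projI pair_wf_digraph_zero_divisor_graph)
      (auto simp: H_def pverts_zero_divisor_graph_boolean_ring
        parcs_zero_divisor_graph_boolean_ring)
  moreover have "digraph_iso (with_proj G) (with_proj H)"
    unfolding H_def using inj by (rule digraph_iso_map_prod)
  moreover have "finite X"
    by (simp add: X_def finite_independent_sets pair_finite_verts)
  ultimately show ?thesis by blast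
qed

end
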